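(* Every separable real Banach space that is lush is a GL-space.
   Context: All spaces are over the real field. $B_E$, $S_E$, $E^*$ denote the closed unit ball, the unit sphere and the dual of $E$. For $x^*\in S_{E^*}$ and $\varepsilon>0$, $S(x^*,\varepsilon)=\{z\in B_E: x^*(z)>1-\varepsilon\}$. A Banach space $E$ is lush if for every $x,y\in S_E$ and every $\varepsilon>0$ there is $x^*\in S_{E^*}$ such that, with $S=S(x^*,\varepsilon)$, $x\in S$ and $\mathrm{dist}(y,\mathrm{aco}(S))<\varepsilon$, where $\mathrm{aco}$ denotes the absolutely convex hull. A Banach space $E$ is a GL-space (generalized-lush space) if for every $x\in S_E$ and every $\varepsilon>0$ there is $x^*\in S_{E^*}$ such that, with $S=S(x^*,\varepsilon)$, one has $x\in S$ and $\mathrm{dist}(y,S)+\mathrm{dist}(y,-S)<2+\varepsilon$ for all $y\in S_E$. *)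

theory Defs
  imports "HOL-Analysis.Analysis"
begin

definition absolutely_convex :: "'a::real_vector set \<Rightarrow> bool" where
  "absolutely_convex C \<longleftrightarrow>
     (\<forall>x\<in>C. \<forall>y\<in>C. \<forall>a b :: real. \<bar>a\<bar> + \<bar>b\<bar> \<le> 1 \<longrightarrow> a *\<^sub>R x + b *\<^sub>R y \<in> C)"

definition aco :: "'a::real_vector set \<Rightarrow> 'a set" where
  "aco S = absolutely_convex hull S"

text \<open>The dual of \<open>'a\<close> is the type \<open>'a \<Rightarrow>\<^sub>L real\<close> of bounded linear functionals
  with the operator norm, so that its unit sphere is \<open>sphere 0 1\<close>.\<close>

definition slice :: "('a::real_normed_vector \<Rightarrow>\<^sub>L real) \<Rightarrow> real \<Rightarrow> 'a set" where
  "slice f \<epsilon> = {z \<in> cball 0 1. blinfun_apply f z > 1 - \<epsilon>}"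

text \<open>The convention \<open>infdist y {} = 0\<close> plays no role in the next two definitions,
  as the slices in them contain \<open>x\<close>.\<close>

definition lush :: "'a::banach itself \<Rightarrow> bool" where
  "lush (_ :: 'a itself) \<longleftrightarrow>
     (\<forall>x\<in>sphere (0::'a) 1. \<forall>y\<in>sphere (0::'a) 1. \<forall>\<epsilon>>0.
        \<exists>f\<in>sphere (0 :: 'a \<Rightarrow>\<^sub>L real) 1.
          x \<in> slice f \<epsilon> \<and> infdist y (aco (slice f \<epsilon>)) < \<epsilon>)"

definition GL_space :: "'a::banach itself \<Rightarrow> bool" where
  "GL_space (_ :: 'a itself) \<longleftrightarrow>
     (\<forall>x\<in>sphere (0::'a) 1. \<forall>\<epsilon>>0.
        \<exists>f\<in>sphere (0 :: 'a \<Rightarrow>\<^sub>L real) 1.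
          x \<in> slice f \<epsilon> \<and>
          (\<forall>y\<in>sphere (0::'a) 1.
             infdist y (slice f \<epsilon>) + infdist y (uminus ` slice f \<epsilon>) < 2 + \<epsilon>))"

end

theory Submission
  imports Defs "HOL-Real_Asymp.Real_Asymp"
begin

text \<open>Let \<open>x\<^sub>0 = x\<close> and let \<open>y\<^sub>n\<close> be dense in the unit sphere. Lushness at \<open>x\<^sub>n, y\<^sub>n\<close> gives a
  slice containing \<open>x\<^sub>n\<close> and points \<open>u\<^sub>n, v\<^sub>n\<close> with \<open>\<parallel>y\<^sub>n - u\<^sub>n\<parallel> + \<parallel>y\<^sub>n + v\<^sub>n\<parallel>\<close> almost at most \<open>2\<close>. Then
  \<open>x\<^sub>n + u\<^sub>n + v\<^sub>n\<close> has norm close to \<open>3\<close>, so a functional of norm at most \<open>1\<close> that almost norms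
  the normalization \<open>x\<^bsub>n+1\<^esub>\<close> of this sum is close to \<open>1\<close> at each of \<open>x\<^sub>n\<close>, \<open>u\<^sub>n\<close>, \<open>v\<^sub>n\<close>.
  By weak* compactness of the dual ball, one functional almost norms all the \<open>x\<^sub>n\<close> at once, and
  its slice is the required one.\<close>

section \<open>Absolutely convex hulls of convex subsets of the unit ball\<close>

lemma absolutely_convexI:
  assumes "convex C" "0 \<in> C" and uminus: "\<And>x. x \<in> C \<Longrightarrow> - x \<in> C"
  shows "absolutely_convex C"
  unfolding absolutely_convex_def
proof (intro ballI allI impI)
  fix x y and a b :: real
  assume x: "x \<in> C" and y: "y \<in> C" and ab: "\<bar>a\<bar> + \<bar>b\<bar> \<le> 1"
  define s where "s = \<bar>a\<bar> + \<bar>b\<bar>"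
  define x' where "x' = (if a \<ge> 0 then x else - x)"
  define y' where "y' = (if b \<ge> 0 then y else - y)"
  have xy': "x' \<in> C" "y' \<in> C"
    using x y uminus by (auto simp: x'_def y'_def)
  have eq: "a *\<^sub>R x + b *\<^sub>R y = \<bar>a\<bar> *\<^sub>R x' + \<bar>b\<bar> *\<^sub>R y'"
    by (simp add: x'_def y'_def)
  show "a *\<^sub>R x + b *\<^sub>R y \<in> C"
  proof (cases "s = 0")
    case True
    then have "a = 0" "b = 0" by (auto simp: s_def)
    then show ?thesis using \<open>0 \<in> C\<close> by simp
  next
    case False
    then have s: "0 < s" "s \<le> 1" using ab by (auto simp: s_def)
    have "(\<bar>a\<bar> / s) *\<^sub>R x' + (\<bar>b\<bar> / s) *\<^sub>R y' \<in> C"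
    proof (intro convexD[OF \<open>convex C\<close>] xy')
      show "\<bar>a\<bar> / s + \<bar>b\<bar> / s = 1"
        using s by (simp add: s_def flip: add_divide_distrib)
    qed (use s in auto)
    then have "s *\<^sub>R ((\<bar>a\<bar> / s) *\<^sub>R x' + (\<bar>b\<bar> / s) *\<^sub>R y') + (1 - s) *\<^sub>R 0 \<in> C"
      by (rule convexD[OF \<open>convex C\<close> _ \<open>0 \<in> C\<close>]) (use s in auto)
    moreover have "s *\<^sub>R ((\<bar>a\<bar> / s) *\<^sub>R x' + (\<bar>b\<bar> / s) *\<^sub>R y') = \<bar>a\<bar> *\<^sub>R x' + \<bar>b\<bar> *\<^sub>R y'"
      using s(1) by (simp add: scaleR_add_right)
    ultimately show ?thesis
      unfolding eq by (metis add.right_neutral scaleR_zero_right)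
  qed
qed

lemma convex_slice: "convex (slice f \<epsilon>)"
proof -
  have "slice f \<epsilon> = cball 0 1 \<inter> blinfun_apply f -` {1 - \<epsilon><..}"
    by (auto simp: slice_def)
  then show ?thesis
    by (simp add: convex_Int convex_linear_vimage blinfun.bounded_linear_right bounded_linear.linear)
qed

text \<open>The set \<open>D\<close> of all \<open>w\<close> admitting such \<open>u\<close> and
  \<open>v\<close> contains \<open>S\<close> (take \<open>u = v = w\<close>), is convex because
  \<open>S\<close> and the norm are, and is symmetric because negating \<open>w\<close> swaps
  \<open>u\<close> and \<open>v\<close>. For nonempty \<open>S\<close> it is thus absolutely convex
  and contains \<open>aco S\<close>.\<close>

lemma aco_norm_diff_add_norm_add:
  fixes S :: "'a::real_normed_vector set"
  assumes "convex S" "S \<subseteq> cball 0 1" "w \<in> aco S"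
  obtains u v where "u \<in> S" "v \<in> S" "norm (w - u) + norm (w + v) \<le> 2"
proof -
  define D where "D = {w. \<exists>u\<in>S. \<exists>v\<in>S. norm (w - u) + norm (w + v) \<le> 2}"
  have ball: "norm x \<le> 1" if "x \<in> S" for x
    using that assms(2) by auto
  have SD: "S \<subseteq> D"
  proof
    fix x assume x: "x \<in> S"
    have "norm (x - x) + norm (x + x) \<le> 2"
      using norm_triangle_ineq[of x x] ball[OF x] by simp
    with x show "x \<in> D" unfolding D_def by blast
  qed
  have "absolutely_convex D" if "S \<noteq> {}"
  proof (rule absolutely_convexI)
    show "convex D"
    proof (rule convexI)
      fix w w' and s t :: real
      assume w: "w \<in> D" and w': "w' \<in> D" and st: "0 \<le> s" "0 \<le> t" "s + t = 1"
      obtain u v where uv: "u \<in> S" "v \<in> S" "norm (w - u) + norm (w + v) \<le> 2"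
        using w by (auto simp: D_def)
      obtain u' v' where uv': "u' \<in> S" "v' \<in> S" "norm (w' - u') + norm (w' + v') \<le> 2"
        using w' by (auto simp: D_def)
      let ?w = "s *\<^sub>R w + t *\<^sub>R w'" and ?u = "s *\<^sub>R u + t *\<^sub>R u'" and ?v = "s *\<^sub>R v + t *\<^sub>R v'"
      have "?w - ?u = s *\<^sub>R (w - u) + t *\<^sub>R (w' - u')" "?w + ?v = s *\<^sub>R (w + v) + t *\<^sub>R (w' + v')"
        by (simp_all add: algebra_simps)
      then have "norm (?w - ?u) \<le> s * norm (w - u) + t * norm (w' - u')"
        "norm (?w + ?v) \<le> s * norm (w + v) + t * norm (w' + v')"
        using st by (metis abs_of_nonneg norm_scaleR norm_triangle_ineq)+
      then have "norm (?w - ?u) + norm (?w + ?v)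
          \<le> s * (norm (w - u) + norm (w + v)) + t * (norm (w' - u') + norm (w' + v'))"
        by (simp add: algebra_simps)
      also have "\<dots> \<le> 2"
        using convex_bound_le[OF uv(3) uv'(3) st] .
      finally show "?w \<in> D"
        using convexD[OF \<open>convex S\<close> uv(1) uv'(1) st] convexD[OF \<open>convex S\<close> uv(2) uv'(2) st]
        unfolding D_def by blast
    qed
    obtain x where x: "x \<in> S" using \<open>S \<noteq> {}\<close> by auto
    have "norm (0 - x) + norm (0 + x) \<le> 2" using ball[OF x] by simp
    with x show "0 \<in> D" unfolding D_def by blast
    fix w assume "w \<in> D"
    then obtain u v where uv: "u \<in> S" "v \<in> S" "norm (w - u) + norm (w + v) \<le> 2"
      by (auto simp: D_def)
    have "norm (- w - v) + norm (- w + u) \<le> 2"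
      using uv(3) norm_minus_cancel[of "w + v"] norm_minus_commute[of w u] by simp
    then show "- w \<in> D" using uv unfolding D_def by blast
  qed
  \<comment> \<open>The empty set is vacuously \<open>absolutely_convex\<close>, so its hull is
    empty and the hypothesis on \<open>w\<close> is contradictory.\<close>
  moreover have "aco S = {}" if "S = {}"
    using hull_minimal[of S "{}" absolutely_convex] that
    by (simp add: aco_def absolutely_convex_def)
  ultimately have "w \<in> D"
    using assms(3) hull_minimal[OF SD, of absolutely_convex] unfolding aco_def by auto
  then show ?thesis using that by (auto simp: D_def)
qed

text \<open>Banach--Alaoglu\<close>

lemma compact_dual_ball_pointwise:
  "compact (blinfun_apply ` cball (0 :: 'a::real_normed_vector \<Rightarrow>\<^sub>L real) 1)"
proof -
  \<comment> \<open>\<open>B\<close> is a product of compact intervals, compact by Tychonoff. The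
    linear functions form the set \<open>L\<close>, closed under pointwise limits, and
    \<open>B \<inter> L\<close> is exactly the dual ball.\<close>
  define B :: "('a \<Rightarrow> real) set" where "B = PiE UNIV (\<lambda>x. cball 0 (norm x))"
  define L :: "('a \<Rightarrow> real) set" where
    "L = (\<Inter>x y. {g. g (x + y) = g x + g y}) \<inter> (\<Inter>r x. {g. g (r *\<^sub>R x) = r * g x})"
  have "compactin (product_topology (\<lambda>_. euclidean) UNIV) B"
    unfolding B_def by (subst compactin_PiE) auto
  then have "compact B"
    by (simp add: euclidean_product_topology)
  moreover have "closed L"
    unfolding L_def
    by (intro closed_Int closed_INT ballI closed_Collect_eq continuous_intros
        continuous_on_product_coordinates)
  moreover have "blinfun_apply ` cball 0 1 = B \<inter> L"
  proof (intro equalityI subsetI)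
    fix g :: "'a \<Rightarrow> real" assume "g \<in> blinfun_apply ` cball 0 1"
    then obtain f where f: "norm f \<le> 1" "g = blinfun_apply f" by auto
    have "\<bar>f x\<bar> \<le> norm x" for x
      using norm_blinfun[of f x] mult_right_mono[OF f(1), of "norm x"] by simp
    then show "g \<in> B \<inter> L"
      by (auto simp: B_def L_def f blinfun.add_right blinfun.scaleR_right)
  next
    fix g assume g: "g \<in> B \<inter> L"
    then have bound: "\<bar>g x\<bar> \<le> norm x" for x
      by (auto simp: B_def PiE_def Pi_def)
    have "bounded_linear g"
      using g bound by (intro bounded_linear_intro[where K = 1]) (auto simp: L_def)
    then have eq: "blinfun_apply (Blinfun g) = g"
      by (rule bounded_linear_Blinfun_apply)
    moreover have "norm (Blinfun g) \<le> 1"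
      by (rule norm_blinfun_bound) (auto simp: eq bound)
    ultimately show "g \<in> blinfun_apply ` cball 0 1"
      by (metis image_eqI mem_cball_0)
  qed
  ultimately show ?thesis
    by (simp add: compact_Int_closed)
qed

text \<open>Each constraint is closed for pointwise convergence, so the finite intersection property
  turns solvability of the initial segments into a common solution.\<close>

lemma dual_ball_sequence_compactness:
  fixes x :: "nat \<Rightarrow> 'a::real_normed_vector" and c :: "nat \<Rightarrow> real"
  assumes "\<And>n. \<exists>f :: 'a \<Rightarrow>\<^sub>L real. norm f \<le> 1 \<and> (\<forall>k\<le>n. c k \<le> blinfun_apply f (x k))"
  obtains f :: "'a \<Rightarrow>\<^sub>L real" where "norm f \<le> 1" "\<And>k. c k \<le> blinfun_apply f (x k)"
proof -
  have "blinfun_apply ` cball (0 :: 'a \<Rightarrow>\<^sub>L real) 1 \<inter> (\<Inter>k\<in>UNIV. {g. c k \<le> g (x k)}) \<noteq> {}"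
  proof (rule compact_imp_fip_image[OF compact_dual_ball_pointwise])
    show "closed {g. c k \<le> g (x k)}" for k
      by (intro closed_Collect_le continuous_intros continuous_on_product_coordinates)
  next
    fix I :: "nat set" assume "finite I"
    then obtain n where "\<forall>k\<in>I. k \<le> n"
      using finite_nat_set_iff_bounded_le by blast
    with assms[of n] obtain f :: "'a \<Rightarrow>\<^sub>L real" where "norm f \<le> 1" "\<forall>k\<in>I. c k \<le> f (x k)"
      by blast
    then show "blinfun_apply ` cball (0 :: 'a \<Rightarrow>\<^sub>L real) 1 \<inter> (\<Inter>k\<in>I. {g. c k \<le> g (x k)}) \<noteq> {}"
      by force
  qed
  then obtain f :: "'a \<Rightarrow>\<^sub>L real" where "norm f \<le> 1" "\<forall>k. c k \<le> f (x k)"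
    by auto
  then show ?thesis using that by blast
qed

text \<open>Normalizing a dense set at most doubles distances to the sphere: \<open>sgn c\<close> is
  no farther from \<open>c\<close> than any unit vector is. The vector \<open>x\<close> ensures that
  a nonzero \<open>c\<close> exists.\<close>

lemma dense_sequence_sphere:
  fixes x :: "'a::real_normed_vector"
  assumes "separable_space (euclidean :: 'a topology)" "norm x = 1"
  obtains y :: "nat \<Rightarrow> 'a" where "\<And>n. norm (y n) = 1"
    and "\<And>z e. norm z = 1 \<Longrightarrow> 0 < e \<Longrightarrow> \<exists>n. norm (z - y n) < e"
proof -
  obtain C :: "'a set" where C: "countable C" "closure C = UNIV"
    using assms(1) by (auto simp: separable_space_def)
  have dense: "\<exists>c\<in>C - {0}. norm (z - sgn c) < e" if z: "norm z = 1" and e: "0 < e" for z e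
  proof -
    \<comment> \<open>The bound 1 forces \<open>c \<noteq> 0\<close>; the bound \<open>e/2\<close>
      absorbs the doubling.\<close>
    have "\<exists>c\<in>C. dist c z < min (e/2) 1"
      using C(2) e closure_approachable[of z C] by (metis UNIV_I half_gt_zero min_less_iff_conj zero_less_one)
    then obtain c where c: "c \<in> C" "dist c z < e/2" "dist c z < 1" by auto
    have "c \<noteq> 0" using c(3) z by auto
    have "norm (c - sgn c) = \<bar>norm c - 1\<bar>"
    proof -
      have "c - sgn c = (norm c - 1) *\<^sub>R sgn c"
        using \<open>c \<noteq> 0\<close> by (simp add: sgn_div_norm algebra_simps)
      then show ?thesis using \<open>c \<noteq> 0\<close> by (simp add: norm_sgn)
    qed
    also have "\<dots> \<le> norm (c - z)"
      using norm_triangle_ineq3[of c z] z by simp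
    finally have "norm (z - sgn c) \<le> 2 * norm (c - z)"
      using norm_triangle_ineq[of "z - c" "c - sgn c"] by (simp add: norm_minus_commute)
    also have "\<dots> < e" using c(2) by (simp add: dist_norm)
    finally show ?thesis using c(1) \<open>c \<noteq> 0\<close> by blast
  qed
  have nonempty: "C - {0} \<noteq> {}"
    using dense[OF assms(2), of 1] by auto
  have range: "range (from_nat_into (C - {0})) = C - {0}"
    using C(1) nonempty by (intro range_from_nat_into) auto
  show ?thesis
  proof
    show "norm (sgn (from_nat_into (C - {0}) n)) = 1" for n
      using from_nat_into[OF nonempty, of n] by (simp add: norm_sgn)
    show "\<exists>n. norm (z - sgn (from_nat_into (C - {0}) n)) < e" if "norm z = 1" "0 < e" for z e
      using dense[OF that] range by (metis imageE)
  qed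
qed

section \<open>One step of the inductive construction\<close>

lemma blinfun_apply_le_norm:
  fixes f :: "'a::real_normed_vector \<Rightarrow>\<^sub>L real"
  assumes "norm f \<le> 1"
  shows "f x \<le> norm x"
  using norm_blinfun[of f x] mult_right_mono[OF assms, of "norm x"] by simp

text \<open>Take for \<open>x'\<close> the normalization of \<open>x + u + v\<close>, whose norm is
  nearly 3. A functional nearly norming it has values at \<open>x\<close>, \<open>u\<close>,
  \<open>v\<close> that are at most 1 and add up to at least \<open>3 - e\<close>, so each is at
  least \<open>1 - e\<close>.\<close>

lemma lush_step:
  fixes x y :: "'a::banach"
  assumes "lush TYPE('a)" "norm x = 1" "norm y = 1" "0 < e" "e \<le> 1"
  obtains x' u v :: 'a where "norm x' = 1" "norm u \<le> 1" "norm v \<le> 1"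
    "norm (y - u) + norm (y + v) < 2 + e"
    "\<And>f :: 'a \<Rightarrow>\<^sub>L real. norm f \<le> 1 \<Longrightarrow> 1 - e / 6 \<le> blinfun_apply f x' \<Longrightarrow>
       1 - e \<le> blinfun_apply f x \<and> 1 - e \<le> blinfun_apply f u \<and> 1 - e \<le> blinfun_apply f v"
proof -
  have "x \<in> sphere 0 1" "y \<in> sphere 0 1" "0 < e / 6" using assms by auto
  then obtain f\<^sub>0 :: "'a \<Rightarrow>\<^sub>L real" where f0: "norm f\<^sub>0 = 1" "x \<in> slice f\<^sub>0 (e / 6)"
    "infdist y (aco (slice f\<^sub>0 (e / 6))) < e / 6"
    using assms(1) unfolding lush_def by (metis mem_sphere_0)
  let ?S = "slice f\<^sub>0 (e / 6)"
  \<comment> \<open>Since \<open>infdist\<close> to the empty set is 0, extracting \<open>w\<close>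
    requires a nonempty hull; \<open>x\<close> lies in it.\<close>
  have "?S \<subseteq> aco ?S" unfolding aco_def by (rule hull_subset)
  then have "aco ?S \<noteq> {}" using f0(2) by auto
  then have "\<exists>w\<in>aco ?S. dist y w < e / 6"
    using f0(3) cInf_lessD[of "dist y ` aco ?S" "e / 6"]
    unfolding infdist_notempty[OF \<open>aco ?S \<noteq> {}\<close>] by blast
  then obtain w where w: "w \<in> aco ?S" "dist y w < e / 6" by blast
  have "?S \<subseteq> cball 0 1" by (auto simp: slice_def)
  then obtain u v where uv: "u \<in> ?S" "v \<in> ?S" "norm (w - u) + norm (w + v) \<le> 2"
    using aco_norm_diff_add_norm_add[OF convex_slice _ w(1)] by blast
  define s where "s = norm (x + u + v)"
  have "3 * (1 - e / 6) < f\<^sub>0 (x + u + v)"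
    using f0(2) uv(1,2) by (simp add: slice_def blinfun.add_right)
  also have "\<dots> \<le> s"
    unfolding s_def using f0(1) by (intro blinfun_apply_le_norm) simp
  finally have s_gt: "3 * (1 - e / 6) < s" .
  have norms: "norm u \<le> 1" "norm v \<le> 1" using uv by (auto simp: slice_def)
  have "0 < s" using s_gt assms(5) by (simp add: right_diff_distrib)
  show ?thesis
  proof
    show "norm ((x + u + v) /\<^sub>R s) = 1"
      using \<open>0 < s\<close> by (simp add: s_def)
    show "norm u \<le> 1" "norm v \<le> 1" by fact+
    have "norm (y - u) \<le> dist y w + norm (w - u)" "norm (y + v) \<le> dist y w + norm (w + v)"
      using norm_triangle_ineq[of "y - w" "w - u"] norm_triangle_ineq[of "y - w" "w + v"]
      by (simp_all add: dist_norm)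
    then show "norm (y - u) + norm (y + v) < 2 + e"
      using uv(3) w(2) \<open>0 < e\<close> by linarith
  next
    fix f :: "'a \<Rightarrow>\<^sub>L real"
    assume f: "norm f \<le> 1" "1 - e / 6 \<le> f ((x + u + v) /\<^sub>R s)"
    \<comment> \<open>Source of the 6: the norm \<open>s\<close> and the value at \<open>x'\<close>
      each lose a factor \<open>1 - e / 6\<close>, and together this costs at most \<open>e\<close>
      out of 3.\<close>
    have "3 - e \<le> 3 * (1 - e / 6) * (1 - e / 6)"
      by (simp add: algebra_simps)
    also have "\<dots> \<le> s * f ((x + u + v) /\<^sub>R s)"
      using s_gt f(2) \<open>0 < s\<close> assms(5) by (intro mult_mono) auto
    also have "\<dots> = f x + f u + f v"
      using \<open>0 < s\<close> by (simp add: blinfun.scaleR_right blinfun.add_right)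
    finally have "3 - e \<le> f x + f u + f v" .
    moreover have "f x \<le> 1" "f u \<le> 1" "f v \<le> 1"
      using blinfun_apply_le_norm[OF f(1)] norms assms(2) order_trans by metis+
    ultimately show "1 - e \<le> f x \<and> 1 - e \<le> f u \<and> 1 - e \<le> f v"
      by linarith
  qed
qed

section \<open>The limiting functional and its slice\<close>

theorem mainTheorem6:
  assumes "separable_space (euclidean :: 'a::banach topology)"
    and "lush TYPE('a)"
  shows "GL_space TYPE('a)"
  unfolding GL_space_def
proof (intro ballI allI impI)
  fix x :: 'a and \<epsilon> :: real
  assume "x \<in> sphere 0 1" and \<epsilon>: "0 < \<epsilon>"
  then have x: "norm x = 1" by simp
  obtain y :: "nat \<Rightarrow> 'a" where y: "\<And>n. norm (y n) = 1"
    and dense: "\<And>z e. norm z = 1 \<Longrightarrow> 0 < e \<Longrightarrow> \<exists>n. norm (z - y n) < e"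
    using dense_sequence_sphere[OF assms(1) x] by blast
  \<comment> \<open>The ratio 6 is the loss in \<open>lush_step\<close>, which also needs the bound
    1. Half of \<epsilon> is kept for approximating \<open>z\<close> by \<open>y n\<close>, used
    twice at cost \<open>\<epsilon> / 4\<close>.\<close>
  define \<delta> :: "nat \<Rightarrow> real" where "\<delta> n = min \<epsilon> 1 / 2 / 6 ^ n" for n
  have \<delta>: "0 < \<delta> n" "\<delta> n \<le> \<epsilon> / 2" "\<delta> n \<le> 1" "\<delta> (Suc n) = \<delta> n / 6" for n
  proof -
    show pos: "0 < \<delta> n" for n using \<epsilon> by (simp add: \<delta>_def)
    show step: "\<delta> (Suc n) = \<delta> n / 6" for n by (simp add: \<delta>_def)
    have "\<delta> n \<le> \<delta> 0"
    proof (rule lift_Suc_antimono_le[of \<delta>])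
      show "\<delta> (Suc k) \<le> \<delta> k" for k using pos[of k] by (simp add: step)
    qed simp
    moreover have "\<delta> 0 \<le> \<epsilon> / 2" "\<delta> 0 \<le> 1" by (auto simp: \<delta>_def)
    ultimately show "\<delta> n \<le> \<epsilon> / 2" "\<delta> n \<le> 1" by linarith+
  qed
  have "\<exists>X. \<forall>n. (norm (X n) = 1 \<and> (n = 0 \<longrightarrow> X n = x)) \<and>
     (\<exists>u v. norm u \<le> 1 \<and> norm v \<le> 1 \<and> norm (y n - u) + norm (y n + v) < 2 + \<delta> n \<and>
       (\<forall>f :: 'a \<Rightarrow>\<^sub>L real. norm f \<le> 1 \<longrightarrow> 1 - \<delta> (Suc n) \<le> blinfun_apply f (X (Suc n)) \<longrightarrow>
          1 - \<delta> n \<le> blinfun_apply f (X n) \<and> 1 - \<delta> n \<le> blinfun_apply f u \<and> 1 - \<delta> n \<le> blinfun_apply f v))"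
  proof (rule dependent_nat_choice, goal_cases)
    case 1
    show ?case using x by auto
  next
    case (2 z n)
    then have "norm z = 1" by simp
    from lush_step[OF assms(2) this y[of n] \<delta>(1,3)[of n]] show ?case
      unfolding \<delta>(4) by (metis nat.distinct(1))
  qed
  then obtain X u v where X: "\<And>n. norm (X n) = 1" "X 0 = x"
    and uv: "\<And>n. norm (u n) \<le> 1" "\<And>n. norm (v n) \<le> 1"
      "\<And>n. norm (y n - u n) + norm (y n + v n) < 2 + \<delta> n"
    and almost_norming: "\<And>n (f :: 'a \<Rightarrow>\<^sub>L real). norm f \<le> 1 \<Longrightarrow> 1 - \<delta> (Suc n) \<le> blinfun_apply f (X (Suc n)) \<Longrightarrow>
          1 - \<delta> n \<le> blinfun_apply f (X n) \<and> 1 - \<delta> n \<le> blinfun_apply f (u n) \<and> 1 - \<delta> n \<le> blinfun_apply f (v n)"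
    by metis
  \<comment> \<open>A functional almost norming \<open>X n\<close> is enough: the estimates descend
    from \<open>n\<close> to 0 along the chain.\<close>
  have "\<exists>f :: 'a \<Rightarrow>\<^sub>L real. norm f \<le> 1 \<and> (\<forall>k\<le>n. 1 - \<delta> k \<le> blinfun_apply f (X k))" for n
  proof -
    have "X n \<in> sphere 0 1" using X by simp
    then obtain f :: "'a \<Rightarrow>\<^sub>L real" where f: "norm f = 1" "X n \<in> slice f (\<delta> n)"
      using assms(2) \<delta>(1)[of n] unfolding lush_def by force
    have "1 - \<delta> k \<le> f (X k)" if "k \<le> n" for k
      using that
    proof (induction k rule: inc_induct)
      case base
      show ?case using f(2) by (simp add: slice_def)
    next
      case (step k)
      then show ?case using almost_norming f(1) by simp
    qed
    with f(1) show ?thesis by (intro exI[of _ f]) auto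
  qed
  then obtain f :: "'a \<Rightarrow>\<^sub>L real" where f: "norm f \<le> 1" "\<And>n. 1 - \<delta> n \<le> f (X n)"
    using dual_ball_sequence_compactness[of "\<lambda>n. 1 - \<delta> n" X] by blast
  \<comment> \<open>Compactness only yields norm at most 1; equality returns because the values at
    the unit vectors \<open>X n\<close> tend to 1.\<close>
  have "1 \<le> norm f"
  proof (rule field_le_epsilon)
    fix e :: real assume "0 < e"
    have "\<delta> \<longlonglongrightarrow> 0" unfolding \<delta>_def by real_asymp
    then obtain n where "\<delta> n < e"
      using \<open>0 < e\<close> by (metis eventually_sequentially order_refl order_tendstoD(2))
    moreover have "f (X n) \<le> norm f"
      using norm_blinfun[of f "X n"] X(1)[of n] by simp
    ultimately show "1 \<le> norm f + e" using f(2)[of n] by linarith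
  qed
  with f(1) have norm_f: "norm f = 1" by simp
  have in_slice: "z \<in> slice f \<epsilon>" if "norm z \<le> 1" "1 - \<delta> n \<le> f z" for z n
    using that \<delta>(2)[of n] \<epsilon> by (simp add: slice_def)
  have "infdist z (slice f \<epsilon>) + infdist z (uminus ` slice f \<epsilon>) < 2 + \<epsilon>" if z: "norm z = 1" for z
  proof -
    obtain n where n: "norm (z - y n) < \<epsilon> / 4"
      using dense[OF z, of "\<epsilon> / 4"] \<epsilon> by auto
    \<comment> \<open>The estimate at \<open>X (Suc n)\<close> controls \<open>u n\<close> and
      \<open>v n\<close>.\<close>
    have "u n \<in> slice f \<epsilon>" "v n \<in> slice f \<epsilon>"
      using almost_norming[OF f(1) f(2), of n] uv in_slice by blast+
    then have "infdist z (slice f \<epsilon>) \<le> dist z (u n)" "infdist z (uminus ` slice f \<epsilon>) \<le> dist z (- v n)"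
      by (auto intro: infdist_le)
    moreover have "dist z (u n) \<le> norm (z - y n) + norm (y n - u n)"
      "dist z (- v n) \<le> norm (z - y n) + norm (y n + v n)"
      using norm_triangle_ineq[of "z - y n" "y n - u n"] norm_triangle_ineq[of "z - y n" "y n + v n"]
      by (simp_all add: dist_norm)
    ultimately show ?thesis
      using n uv(3)[of n] \<delta>(2)[of n] by linarith
  qed
  moreover have "x \<in> slice f \<epsilon>"
    using in_slice[of x 0] f(2)[of 0] X(2) x by simp
  ultimately show "\<exists>f\<in>sphere 0 1. x \<in> slice f \<epsilon> \<and>
      (\<forall>z\<in>sphere 0 1. infdist z (slice f \<epsilon>) + infdist z (uminus ` slice f \<epsilon>) < 2 + \<epsilon>)"
    using norm_f by (intro bexI[of _ f]) auto
qed

end
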